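(* Let $F$ be a field with a valuation $v$ and valuation ring $O_v$, let $E/F$ be a finite field extension, let $w$ be a quasi-valuation on $E$ extending $v$, and let $O_w=\{x\in E\mid w(x)\ge0\}$. Then $O_w$ and $O_v$ have the same Krull dimension: $\text{K-dim}\,O_w=\text{K-dim}\,O_v$.
   Context: A totally ordered abelian monoid is a commutative monoid $(M,+)$ with a total order such that $a\le b$ implies $a+c\le b+c$. One adjoins $\infty$, greater than all elements of $M$, with $m+\infty=\infty$. A quasi-valuation on a ring $A$ is a function $w:A\to M\cup\{\infty\}$, $M$ a totally ordered abelian monoid, with $w(0)=\infty$, $w(xy)\ge w(x)+w(y)$ and $w(x+y)\ge\min\{w(x),w(y)\}$ for all $x,y\in A$. $w$ extends $v$ means that the value group $\Gamma_v$ of $v$ is contained in $M$ as an ordered submonoid and $w|_F=v$. K-dim denotes the classical Krull dimension (with value in $\mathbb N\cup\{0,\infty\}$). *)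

theory Defs
  imports
    "HOL-Algebra.Embedded_Algebras"
    "HOL-Library.Extended_Nat"
    "HOL-Library.Lattice_Constructions"
begin

section \<open>Adjoining infinity to an ordered monoid\<close>

text \<open>
  The type \<^typ>\<open>'m top\<close> with its library order is \<open>M \<union> {\<infinity>}\<close>, where \<^term>\<open>top.Top\<close> plays the role
  of \<open>\<infinity>\<close>. A totally ordered abelian monoid is a type in
  \<open>{linorder, ordered_comm_monoid_add}\<close>: monotonicity of addition is only the weak one, and
  cancellation is not assumed.
\<close>

instantiation top :: (comm_monoid_add) comm_monoid_add
begin

definition zero_top :: "'a top" where
  "zero_top = top.Value 0"

fun plus_top :: "'a top \<Rightarrow> 'a top \<Rightarrow> 'a top" where
  "plus_top (top.Value a) (top.Value b) = top.Value (a + b)"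
| "plus_top top.Top y = top.Top"
| "plus_top x top.Top = top.Top"

instance
proof
  fix a b c :: "'a top"
  show "a + b + c = a + (b + c)"
    by (cases a; cases b; cases c) (simp_all add: add.assoc)
  show "a + b = b + a"
    by (cases a; cases b) (simp_all add: add.commute)
  show "0 + a = a"
    by (cases a) (simp_all add: zero_top_def)
qed

end

instance top :: (ordered_comm_monoid_add) ordered_comm_monoid_add
proof
  fix a b c :: "'a top"
  assume "a \<le> b"
  then show "c + a \<le> c + b"
    by (cases a; cases b; cases c) (simp_all add: add_left_mono)
qed


section \<open>Valuations and quasi-valuations\<close>

locale valuation = field K for K (structure) +
  fixes v :: "'a \<Rightarrow> ('g :: linordered_ab_group_add) top"
  assumes v_eq_Top_iff: "x \<in> carrier K \<Longrightarrow> v x = top.Top \<longleftrightarrow> x = \<zero>"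
    and v_mult: "\<lbrakk>x \<in> carrier K; y \<in> carrier K\<rbrakk> \<Longrightarrow> v (x \<otimes> y) = v x + v y"
    and v_add: "\<lbrakk>x \<in> carrier K; y \<in> carrier K\<rbrakk> \<Longrightarrow> v (x \<oplus> y) \<ge> min (v x) (v y)"

locale quasi_valuation = ring A for A (structure) +
  fixes w :: "'a \<Rightarrow> ('m :: {linorder, ordered_comm_monoid_add}) top"
  assumes w_zero: "w \<zero> = top.Top"
    and w_mult: "\<lbrakk>x \<in> carrier A; y \<in> carrier A\<rbrakk> \<Longrightarrow> w (x \<otimes> y) \<ge> w x + w y"
    and w_add: "\<lbrakk>x \<in> carrier A; y \<in> carrier A\<rbrakk> \<Longrightarrow> w (x \<oplus> y) \<ge> min (w x) (w y)"

text \<open>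
  The valuation \<^term>\<open>v\<close> need not be onto \<^typ>\<open>'g\<close>; its value group is the set of its finite
  values.
\<close>

definition value_group :: "'a set \<Rightarrow> ('a \<Rightarrow> 'g top) \<Rightarrow> 'g set" where
  "value_group F v = {\<gamma>. \<exists>x\<in>F. v x = top.Value \<gamma>}"

text \<open>
  The value group of \<^term>\<open>v\<close> and the monoid of \<^term>\<open>w\<close> live on different types, so the inclusion
  of the former into the latter as an ordered submonoid is an embedding \<open>\<iota>\<close>. Both orders being
  total, strict monotonicity means that \<open>\<iota>\<close> preserves and reflects the order.
\<close>

definition extends_valuation ::
  "'a set \<Rightarrow> ('a \<Rightarrow> ('g :: linordered_ab_group_add) top) \<Rightarrow>
    ('a \<Rightarrow> ('m :: {linorder, ordered_comm_monoid_add}) top) \<Rightarrow> bool" where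
  "extends_valuation F v w \<longleftrightarrow>
    (\<exists>\<iota> :: 'g \<Rightarrow> 'm.
      \<iota> 0 = 0 \<and>
      (\<forall>\<alpha>\<in>value_group F v. \<forall>\<beta>\<in>value_group F v. \<iota> (\<alpha> + \<beta>) = \<iota> \<alpha> + \<iota> \<beta>) \<and>
      strict_mono_on (value_group F v) \<iota> \<and>
      (\<forall>x\<in>F. w x = map_top \<iota> (v x)))"

text \<open>The ring \<open>O\<^sub>w\<close> of a (quasi-)valuation, with the operations inherited from \<^term>\<open>A\<close>.\<close>

definition valuation_ring ::
  "('a, 'b) ring_scheme \<Rightarrow> ('a \<Rightarrow> ('m :: {linorder, ordered_comm_monoid_add}) top) \<Rightarrow>
    ('a, 'b) ring_scheme" where
  "valuation_ring A w = A\<lparr>carrier := {x \<in> carrier A. w x \<ge> 0}\<rparr>"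


section \<open>Krull dimension\<close>

text \<open>
  The supremum of the lengths \<open>n\<close> of chains \<open>P 0 \<subset> \<dots> \<subset> P n\<close> of prime ideals. Only meaningful for
  commutative rings, as commutativity is part of \<^const>\<open>primeideal\<close>; the zero ring gets the
  value \<open>0\<close>.
\<close>

definition krull_dim :: "('a, 'b) ring_scheme \<Rightarrow> enat" where
  "krull_dim R = Sup {enat n | n. \<exists>P :: nat \<Rightarrow> 'a set.
    (\<forall>i\<le>n. primeideal (P i) R) \<and> (\<forall>i<n. P i \<subset> P (Suc i))}"

end

theory Submission
  imports Defs "HOL-Algebra.Finite_Extensions"
begin

text \<open>
  Only three facts about \<open>A = O\<^sub>w\<close> matter: it is a subring of \<open>E\<close>, its trace on \<open>F\<close> is
  \<open>V = O\<^sub>v\<close>, and \<open>V\<close> contains \<open>x\<close> or \<open>x\<inverse>\<close> for every nonzero \<open>x\<close> in \<open>F\<close>.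

  Contraction is strict on chains: let \<open>P \<subset> Q\<close> be primes of \<open>A\<close> with the same trace \<open>\<pp>\<close> on \<open>V\<close>
  and \<open>x \<in> Q - P\<close>. Scale an algebraic equation of \<open>x\<close> over \<open>F\<close> so that its coefficients lie in
  \<open>V\<close> and one of them is \<open>1\<close>. Reducing modulo \<open>Q\<close> puts the constant term in \<open>\<pp>\<close>, hence in
  \<open>P\<close>; cancelling \<open>x \<notin> P\<close> and iterating puts all coefficients in \<open>\<pp>\<close>, a contradiction.

  Chains lift: as \<open>V\<close> is a valuation ring, \<open>\<pp>A = {a y | a \<in> \<pp>, y \<in> A}\<close>, and \<open>s t \<in> \<pp>A\<close> with
  \<open>s \<in> V - \<pp>\<close> forces \<open>t \<in> \<pp>A\<close>. So a prime of \<open>A\<close> containing \<open>\<pp>A\<close> and avoiding \<open>V - \<pp>\<close> can be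
  chosen to avoid any multiplicative set \<open>U\<close> disjoint from \<open>\<pp>A\<close>. Taking \<open>U = {1}\<close> gives lying
  over, and taking \<open>U\<close> to be the complement of a prime gives going down.
\<close>

section \<open>Ideals of commutative rings\<close>

lemma (in cring) ideal_iff:
  "ideal I R \<longleftrightarrow> I \<subseteq> carrier R \<and> \<zero> \<in> I \<and> (\<forall>a\<in>I. \<forall>b\<in>I. a \<oplus> b \<in> I) \<and>
    (\<forall>a\<in>carrier R. \<forall>b\<in>I. a \<otimes> b \<in> I)"
    (is "_ \<longleftrightarrow> ?rhs")
proof
  assume "ideal I R"
  then interpret ideal I R .
  show ?rhs
    using a_subset I_l_closed by auto
next
  assume r: ?rhs
  have "\<ominus> a \<in> I" if "a \<in> I" for a
  proof -
    have "a \<in> carrier R" using r that by blast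
    then have "\<ominus> a = (\<ominus> \<one>) \<otimes> a" by (simp add: l_minus)
    then show ?thesis using r that by simp
  qed
  then have "subgroup I (add_monoid R)"
    using r by (intro add.subgroupI) (auto simp: a_inv_def)
  moreover have "a \<otimes> b \<in> I" if "a \<in> I" "b \<in> carrier R" for a b
    using r that m_comm[of a b] by auto
  ultimately show "ideal I R"
    using r by (intro idealI ring_axioms) auto
qed

lemma (in cring) primeideal_iff:
  "primeideal P R \<longleftrightarrow> ideal P R \<and> \<one> \<notin> P \<and>
    (\<forall>a\<in>carrier R. \<forall>b\<in>carrier R. a \<otimes> b \<in> P \<longrightarrow> a \<in> P \<or> b \<in> P)"
proof -
  have "\<one> \<in> P \<longleftrightarrow> carrier R = P" if "ideal P R"
    using ideal.one_imp_carrier[OF that] by auto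
  then show ?thesis
    using primeidealI[of P R] is_cring primeideal.axioms(1)[of P R]
      primeideal.I_notcarr[of P R] primeideal.I_prime[of P R] by blast
qed

text \<open>Krull's lemma: by Zorn there is an ideal maximal among those containing \<open>I\<close>
  and missing the multiplicative set \<open>S\<close>, and such an ideal is prime.\<close>

lemma (in cring) exists_primeideal_disjoint:
  assumes I: "ideal I R" and S: "S \<subseteq> carrier R" "\<one> \<in> S"
    and S_mult: "\<And>s t. \<lbrakk>s \<in> S; t \<in> S\<rbrakk> \<Longrightarrow> s \<otimes> t \<in> S"
    and disj: "I \<inter> S = {}"
  obtains P where "primeideal P R" "I \<subseteq> P" "P \<inter> S = {}"
proof -
  let ?J = "{J. ideal J R \<and> I \<subseteq> J \<and> J \<inter> S = {}}"
  have "\<exists>M\<in>?J. \<forall>J\<in>?J. M \<subseteq> J \<longrightarrow> J = M"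
  proof (rule subset_Zorn_nonempty)
    show "?J \<noteq> {}" using I disj by blast
  next
    fix C assume C: "C \<noteq> {}" "subset.chain ?J C"
    then have sub: "C \<subseteq> ?J" and "subset.chain {J. ideal J R} C"
      unfolding subset_chain_def by auto
    then have "ideal (\<Union>C) R"
      using chain_Union_is_ideal[of C] C(1) by simp
    then show "\<Union>C \<in> ?J" using C(1) sub by blast
  qed
  then obtain M where "M \<in> ?J" and max: "\<And>J. \<lbrakk>J \<in> ?J; M \<subseteq> J\<rbrakk> \<Longrightarrow> J = M"
    by meson
  then have M: "ideal M R" "I \<subseteq> M" "M \<inter> S = {}" by simp_all
  interpret M: ideal M R by fact
  \<comment> \<open>By maximality, the strictly larger ideal \<open>M + (a)\<close> cannot miss
    \<open>S\<close>.\<close>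
  have meets: "\<exists>m\<in>M. \<exists>r\<in>carrier R. m \<oplus> r \<otimes> a \<in> S" if a: "a \<in> carrier R" "a \<notin> M" for a
  proof (rule ccontr)
    assume none: "\<not> ?thesis"
    let ?N = "M <+>\<^bsub>R\<^esub> PIdl a"
    have N: "ideal ?N R"
      by (intro add_ideals cgenideal_ideal M(1) a(1))
    have N_I: "m \<oplus> n \<in> ?N" if "m \<in> M" "n \<in> PIdl a" for m n
      using that unfolding set_add_def' by blast
    have "m \<in> ?N" if "m \<in> M" for m
    proof -
      have "\<zero> \<in> PIdl a" using cgenideal_ideal[OF a(1)] unfolding ideal_iff by blast
      then show ?thesis using N_I[OF that] M.Icarr[OF that] by fastforce
    qed
    moreover have "a \<in> ?N"
      using N_I[of \<zero> a] cgenideal_self[OF a(1)] a(1) by simp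
    moreover have "?N \<inter> S = {}"
      using none unfolding set_add_def' cgenideal_def by auto
    ultimately have "?N = M" using N M(2) by (intro max) auto
    then show False using \<open>a \<in> ?N\<close> a(2) by simp
  qed
  have "a \<in> M \<or> b \<in> M" if ab: "a \<in> carrier R" "b \<in> carrier R" "a \<otimes> b \<in> M" for a b
  proof (rule ccontr)
    assume "\<not> ?thesis"
    then obtain m r n s where h: "m \<in> M" "r \<in> carrier R" "m \<oplus> r \<otimes> a \<in> S"
      "n \<in> M" "s \<in> carrier R" "n \<oplus> s \<otimes> b \<in> S"
      using meets ab by meson
    have c: "m \<in> carrier R" "n \<in> carrier R" using h M.Icarr by auto
    \<comment> \<open>Every term of the expanded product contains \<open>m\<close>, \<open>n\<close>
      or \<open>a \<otimes> b\<close>, all of which lie in \<open>M\<close>.\<close>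
    have "(m \<oplus> r \<otimes> a) \<otimes> (n \<oplus> s \<otimes> b) =
        (n \<oplus> s \<otimes> b) \<otimes> m \<oplus> ((r \<otimes> a) \<otimes> n \<oplus> (r \<otimes> s) \<otimes> (a \<otimes> b))"
      using c h(2,5) ab by algebra
    also have "\<dots> \<in> M"
      using c h ab by (simp add: M.a_closed M.I_l_closed)
    finally show False using S_mult[OF h(3,6)] M(3) by blast
  qed
  then have "primeideal M R"
    unfolding primeideal_iff using M S(2) by blast
  then show thesis using that M by blast
qed

section \<open>Algebraic extensions of a valuation ring\<close>

text \<open>\<open>A\<close> stands for \<open>O_w\<close> and \<open>A \<inter> F\<close> for
  \<open>O_v\<close>. As \<open>inv x\<close> lies in \<open>F\<close>, the last assumption makes
  \<open>A \<inter> F\<close> a valuation ring of \<open>F\<close>.\<close>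

locale algebraic_extension_of_valuation_ring = field E for E (structure) +
  fixes F A :: "'a set"
  assumes F: "subfield F E" and A: "subring A E"
    and algebraic: "x \<in> carrier E \<Longrightarrow> (algebraic over F) x"
    and dichotomy: "\<lbrakk>x \<in> F; x \<noteq> \<zero>\<rbrakk> \<Longrightarrow> x \<in> A \<or> inv x \<in> A"
begin

abbreviation RA where "RA \<equiv> E\<lparr>carrier := A\<rparr>"
abbreviation RV where "RV \<equiv> E\<lparr>carrier := A \<inter> F\<rparr>"

lemmas A_closed = subringE[OF A] and F_closed = subringE[OF subfieldE(1)[OF F]]

lemma F_inv_closed: "\<lbrakk>x \<in> F; x \<noteq> \<zero>\<rbrakk> \<Longrightarrow> inv x \<in> F"
  using subfield_m_inv(1)[OF F] by auto

lemma V_subring: "subring (A \<inter> F) E"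
  using A_closed F_closed by (intro subringI) auto

lemma ideal_RA_iff: "ideal I RA \<longleftrightarrow> I \<subseteq> A \<and> \<zero> \<in> I \<and> (\<forall>a\<in>I. \<forall>b\<in>I. a \<oplus> b \<in> I) \<and>
    (\<forall>a\<in>A. \<forall>b\<in>I. a \<otimes> b \<in> I)"
  using cring.ideal_iff[OF domain.axioms(1)[OF subring_is_domain[OF A]]] by simp

lemma primeideal_RA_iff: "primeideal P RA \<longleftrightarrow> ideal P RA \<and> \<one> \<notin> P \<and>
    (\<forall>a\<in>A. \<forall>b\<in>A. a \<otimes> b \<in> P \<longrightarrow> a \<in> P \<or> b \<in> P)"
  using cring.primeideal_iff[OF domain.axioms(1)[OF subring_is_domain[OF A]]] by simp

lemma ideal_RV_iff: "ideal I RV \<longleftrightarrow> I \<subseteq> A \<inter> F \<and> \<zero> \<in> I \<and>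
    (\<forall>a\<in>I. \<forall>b\<in>I. a \<oplus> b \<in> I) \<and> (\<forall>a\<in>A \<inter> F. \<forall>b\<in>I. a \<otimes> b \<in> I)"
  using cring.ideal_iff[OF domain.axioms(1)[OF subring_is_domain[OF V_subring]]] by simp

lemma primeideal_RV_iff: "primeideal P RV \<longleftrightarrow> ideal P RV \<and> \<one> \<notin> P \<and>
    (\<forall>a\<in>A \<inter> F. \<forall>b\<in>A \<inter> F. a \<otimes> b \<in> P \<longrightarrow> a \<in> P \<or> b \<in> P)"
  using cring.primeideal_iff[OF domain.axioms(1)[OF subring_is_domain[OF V_subring]]] by simp

lemma primeideal_contraction:
  assumes "primeideal P RA"
  shows "primeideal (P \<inter> F) RV"
  using assms F_closed(2,6,7)
  unfolding primeideal_RA_iff primeideal_RV_iff ideal_RA_iff ideal_RV_iff by simp blast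

section \<open>Divisibility and scaled algebraic equations\<close>

text \<open>For nonzero elements, \<open>b/a\<close> and \<open>a/b\<close> are mutually inverse in
  \<open>F\<close>, so one of them lies in the valuation ring; zero is a multiple of
  everything.\<close>

lemma divides_or_divides:
  assumes "a \<in> F" "b \<in> F"
  shows "(\<exists>c\<in>A \<inter> F. b = a \<otimes> c) \<or> (\<exists>c\<in>A \<inter> F. a = b \<otimes> c)"
proof (cases "a = \<zero> \<or> b = \<zero>")
  case True
  then show ?thesis
    using assms A_closed F_closed by (metis IntI r_null subsetD)
next
  case False
  have c: "a \<in> carrier E" "b \<in> carrier E" "a \<in> Units E" "b \<in> Units E"
    using assms F_closed False field_Units by auto
  let ?c = "inv a \<otimes> b"
  have cF: "?c \<in> F" using assms False F_closed F_inv_closed by auto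
  have "(inv a \<otimes> b) \<otimes> (inv b \<otimes> a) = inv a \<otimes> ((b \<otimes> inv b) \<otimes> a)"
    using c by (simp only: m_assoc m_closed Units_inv_closed)
  also have "\<dots> = \<one>" using c by simp
  finally have inv_c: "inv ?c = inv b \<otimes> a"
    using c by (intro comm_inv_char) simp_all
  have "inv b \<otimes> a \<in> F" using assms False F_closed F_inv_closed by auto
  moreover have "?c \<noteq> \<zero>"
    using False c by (metis Units_inv_closed Units_r_inv m_assoc l_one r_null)
  ultimately have "?c \<in> A \<inter> F \<or> inv b \<otimes> a \<in> A \<inter> F"
    using dichotomy[OF cF] cF inv_c by auto
  moreover have "b = a \<otimes> ?c" "a = b \<otimes> (inv b \<otimes> a)"
    using c by (simp_all add: m_assoc[symmetric])
  ultimately show ?thesis by blast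
qed

text \<open>Divisibility by the valuation ring is a total preorder on \<open>F\<close>; the common
  divisor is an element of least value.\<close>

lemma exists_common_divisor:
  assumes "finite C" "C \<noteq> {}" "C \<subseteq> F"
  shows "\<exists>c\<in>C. \<forall>b\<in>C. \<exists>d\<in>A \<inter> F. b = c \<otimes> d"
  using assms
proof (induction rule: finite_ne_induct)
  case (singleton x)
  then show ?case using A_closed F_closed by (auto intro!: bexI[of _ \<one>])
next
  case (insert x C)
  then obtain c where c: "c \<in> C" "\<forall>b\<in>C. \<exists>d\<in>A \<inter> F. b = c \<otimes> d" by auto
  have F: "c \<in> F" "x \<in> F" using c insert by auto
  have one: "\<exists>d\<in>A \<inter> F. x = x \<otimes> d"
    using F A_closed F_closed by (auto intro!: bexI[of _ \<one>])
  from divides_or_divides[OF F] show ?case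
  proof
    assume "\<exists>d\<in>A \<inter> F. x = c \<otimes> d"
    then show ?thesis using c by blast
  next
    assume "\<exists>d\<in>A \<inter> F. c = x \<otimes> d"
    then obtain d where d: "d \<in> A \<inter> F" "c = x \<otimes> d" by blast
    have "\<exists>e\<in>A \<inter> F. b = x \<otimes> e" if b: "b \<in> C" for b
    proof -
      obtain e where e: "e \<in> A \<inter> F" "b = c \<otimes> e" using c(2) b by blast
      have "x \<in> carrier E" "d \<in> carrier E" "e \<in> carrier E"
        using d(1) e(1) F(2) F_closed(1) by auto
      then have "b = x \<otimes> (d \<otimes> e)" using m_assoc[of x d e] e(2) d(2) by simp
      moreover have "d \<otimes> e \<in> A \<inter> F"
        using d(1) e(1) A_closed(6) F_closed(6) by simp
      ultimately show ?thesis by blast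
    qed
    then show ?thesis using one by blast
  qed
qed

text \<open>An algebraic equation is divided by a coefficient of least value. The coefficient
  \<open>\<one>\<close> may stand anywhere, so the equation need not be monic.\<close>

lemma exists_integral_equation:
  assumes "x \<in> carrier E"
  obtains q where "set q \<subseteq> A \<inter> F" "\<one> \<in> set q" "eval q x = \<zero>"
proof -
  obtain p where p: "p \<in> carrier (F[X])" "p \<noteq> []" "eval p x = \<zero>"
    using algebraicE[OF subfieldE(1)[OF F] assms algebraic[OF assms]] .
  then have pF: "set p \<subseteq> F" and nz: "lead_coeff p \<noteq> \<zero>" "lead_coeff p \<in> set p"
    unfolding univ_poly_def polynomial_def by auto
  obtain c where c: "c \<in> set p" "\<forall>b\<in>set p. \<exists>d\<in>A \<inter> F. b = c \<otimes> d"
    using exists_common_divisor[of "set p"] p(2) pF by auto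
  have cE: "c \<in> carrier E" using c(1) pF F_closed by auto
  \<comment> \<open>\<open>c\<close> divides the nonzero leading coefficient.\<close>
  have "c \<noteq> \<zero>"
  proof
    assume "c = \<zero>"
    moreover obtain d where "d \<in> A" "lead_coeff p = c \<otimes> d"
      using c(2) nz(2) by blast
    ultimately show False using nz A_closed(1) by auto
  qed
  then have u: "c \<in> Units E" using cE field_Units by auto
  have scale: "eval (map ((\<otimes>) k) r) x = k \<otimes> eval r x" if "set r \<subseteq> carrier E" "k \<in> carrier E" for k r
    using that
  proof (induction r)
    case (Cons a r)
    then show ?case
      using assms eval_in_carrier[of r x] by (simp add: m_assoc r_distr)
  qed simp
  let ?q = "map ((\<otimes>) (inv c)) p"
  have "inv c \<otimes> b \<in> A \<inter> F" if b: "b \<in> set p" for b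
  proof -
    obtain d where d: "d \<in> A \<inter> F" "b = c \<otimes> d" using c(2) b by blast
    then have "inv c \<otimes> b = d"
      using u cE A_closed m_assoc[of "inv c" c d] by auto
    then show ?thesis using d by simp
  qed
  moreover have "inv c \<otimes> c = \<one>" using u by simp
  then have "\<one> \<in> set ?q" using c(1) by force
  moreover have "eval ?q x = \<zero>"
    using scale[of p "inv c"] p(3) pF F_closed u by auto
  ultimately show thesis using that[of ?q] by auto
qed

section \<open>Strictness of contraction\<close>

lemma incomparability:
  assumes P: "primeideal P RA" and Q: "primeideal Q RA" and "P \<subset> Q"
  shows "P \<inter> F \<subset> Q \<inter> F"
proof (rule ccontr)
  assume "\<not> ?thesis"
  with \<open>P \<subset> Q\<close> have eq: "P \<inter> F = Q \<inter> F" by blast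
  obtain x where x: "x \<in> Q" "x \<notin> P" using \<open>P \<subset> Q\<close> by blast
  note iffs = primeideal_RA_iff ideal_RA_iff
  have xA: "x \<in> A" "x \<in> carrier E" using Q x A_closed unfolding iffs by auto
  \<comment> \<open>Membership in \<open>P\<close> replaces vanishing so that the argument can be
    iterated. Lists start with the leading coefficient, so \<open>rev_induct\<close> strips the
    constant term.\<close>
  have coeffs: "set q \<subseteq> P" if "set q \<subseteq> A \<inter> F" "eval q x \<in> P" for q
    using that
  proof (induction q rule: rev_induct)
    case Nil
    then show ?case by simp
  next
    case (snoc a q)
    have a: "a \<in> A" "a \<in> F" "a \<in> carrier E" using snoc.prems A_closed by auto
    have qE: "set q \<subseteq> carrier E" using snoc.prems A_closed by auto
    have ev: "eval (q @ [a]) x = eval q x \<otimes> x \<oplus> a"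
      by (rule eval_append_aux[OF qE a(3) xA(2)])
    have e: "eval q x \<in> A"
    proof -
      have "eval r x \<in> A" if "set r \<subseteq> A" for r
        using that
      proof (induction r)
        case Nil
        then show ?case using A_closed by simp
      next
        case (Cons b r)
        have "x [^] (n::nat) \<in> A" for n
          using xA A_closed by (induction n) auto
        then show ?case using Cons A_closed by simp
      qed
      then show ?thesis using snoc.prems by auto
    qed
    have eE: "eval q x \<otimes> x \<in> carrier E" using e xA A_closed by auto
    have PQ: "P \<subseteq> Q" and Qm: "\<And>b c. b \<in> A \<Longrightarrow> c \<in> Q \<Longrightarrow> b \<otimes> c \<in> Q"
      and Qa: "\<And>b c. b \<in> Q \<Longrightarrow> c \<in> Q \<Longrightarrow> b \<oplus> c \<in> Q"
      and Pm: "\<And>b c. b \<in> A \<Longrightarrow> c \<in> P \<Longrightarrow> b \<otimes> c \<in> P"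
      and Pa: "\<And>b c. b \<in> P \<Longrightarrow> c \<in> P \<Longrightarrow> b \<oplus> c \<in> P"
      and Pp: "\<And>b c. b \<in> A \<Longrightarrow> c \<in> A \<Longrightarrow> b \<otimes> c \<in> P \<Longrightarrow> b \<in> P \<or> c \<in> P"
      using P Q \<open>P \<subset> Q\<close> unfolding iffs by auto
    have m1: "\<ominus> \<one> \<in> A" using A_closed by auto
    \<comment> \<open>The value of the whole polynomial lies in \<open>P \<subset> Q\<close> and
      \<open>x\<close> lies in \<open>Q\<close>, hence so does \<open>a\<close>; equal traces then
      put \<open>a\<close> into \<open>P\<close>. Subtraction is written as multiplication by
      \<open>\<ominus> \<one>\<close> to use absorption.\<close>
    have "a = eval (q @ [a]) x \<oplus> (\<ominus> \<one> \<otimes> eval q x) \<otimes> x"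
      unfolding ev using a(3) e xA A_closed(1) by (auto simp: l_minus a_ac r_neg2 r_neg)
    moreover have "eval (q @ [a]) x \<in> Q" using snoc.prems PQ by blast
    moreover have "(\<ominus> \<one> \<otimes> eval q x) \<otimes> x \<in> Q"
      using m1 e x A_closed by (intro Qm) auto
    ultimately have "a \<in> Q" using Qa by metis
    then have aP: "a \<in> P" using a eq by blast
    have "eval q x \<otimes> x = eval (q @ [a]) x \<oplus> \<ominus> \<one> \<otimes> a"
      unfolding ev using a(3) eE by (simp add: l_minus a_assoc r_neg)
    also have "\<dots> \<in> P" using snoc.prems aP m1 by (intro Pa Pm) auto
    \<comment> \<open>The factor \<open>x\<close> lies outside the prime \<open>P\<close> and can be
      cancelled.\<close>
    finally have "eval q x \<in> P" using Pp[OF e xA(1)] x by blast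
    then show ?case using snoc aP by auto
  qed
  \<comment> \<open>The coefficient \<open>\<one>\<close> would have to lie in the proper ideal
    \<open>P\<close>.\<close>
  obtain q where "set q \<subseteq> A \<inter> F" "\<one> \<in> set q" "eval q x = \<zero>"
    using exists_integral_equation[OF xA(2)] .
  then show False using coeffs[of q] P unfolding iffs by auto
qed

section \<open>Extension of prime ideals\<close>

text \<open>Single products replace the finite sums of the usual extension of \<open>\<pp>\<close>
  to \<open>A\<close>, since of two elements of \<open>\<pp>\<close> one divides the other.\<close>

definition extended_ideal :: "'a set \<Rightarrow> 'a set" where
  "extended_ideal \<pp> = {a \<otimes> y | a y. a \<in> \<pp> \<and> y \<in> A}"

text \<open>Only sums need care: if \<open>b = a \<otimes> c\<close>, then \<open>a\<close> can be
  factored out of \<open>a \<otimes> y \<oplus> b \<otimes> z\<close>; the other case is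
  symmetric.\<close>

lemma ideal_extended_ideal:
  assumes "ideal \<pp> RV"
  shows "ideal (extended_ideal \<pp>) RA"
proof -
  have p: "\<pp> \<subseteq> A" "\<pp> \<subseteq> F" "\<zero> \<in> \<pp>" using assms unfolding ideal_RV_iff by auto
  have mult: "a \<otimes> y \<in> extended_ideal \<pp>" if "a \<in> \<pp>" "y \<in> A" for a y
    using that unfolding extended_ideal_def by blast
  have add: "a \<otimes> y \<oplus> b \<otimes> z \<in> extended_ideal \<pp>"
    if h: "a \<in> \<pp>" "b \<in> \<pp>" "y \<in> A" "z \<in> A" "c \<in> A \<inter> F" "b = a \<otimes> c" for a b c y z
  proof -
    have "a \<otimes> y \<oplus> b \<otimes> z = a \<otimes> (y \<oplus> c \<otimes> z)"
    proof -
      have "a \<in> carrier E" "y \<in> carrier E" "z \<in> carrier E" "c \<in> carrier E"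
        using h p A_closed(1) by auto
      then show ?thesis unfolding \<open>b = a \<otimes> c\<close> by algebra
    qed
    moreover have "y \<oplus> c \<otimes> z \<in> A" using h A_closed(6,7) by simp
    ultimately show ?thesis using mult h(1) by simp
  qed
  have "a \<otimes> y \<oplus> b \<otimes> z \<in> extended_ideal \<pp>"
    if h: "a \<in> \<pp>" "b \<in> \<pp>" "y \<in> A" "z \<in> A" for a b y z
  proof -
    have "a \<in> F" "b \<in> F" using h p by auto
    moreover have "a \<otimes> y \<oplus> b \<otimes> z = b \<otimes> z \<oplus> a \<otimes> y"
      using h p A_closed(1) by (intro a_comm m_closed) auto
    ultimately show ?thesis
      using divides_or_divides[of a b] add[of a b y z] add[of b a z y] h by metis
  qed
  moreover have "r \<otimes> (a \<otimes> y) \<in> extended_ideal \<pp>"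
    if h: "a \<in> \<pp>" "y \<in> A" "r \<in> A" for a y r
  proof -
    have "r \<otimes> (a \<otimes> y) = a \<otimes> (r \<otimes> y)"
      using h p A_closed(1) by (intro m_lcomm) auto
    then show ?thesis using mult h A_closed(6) by simp
  qed
  moreover have "\<zero> \<in> extended_ideal \<pp>"
    using mult[OF p(3) A_closed(2)] by simp
  moreover have "extended_ideal \<pp> \<subseteq> A"
    using p(1) A_closed(6) unfolding extended_ideal_def by auto
  ultimately show ?thesis
    unfolding ideal_RA_iff extended_ideal_def by blast
qed

text \<open>Being outside \<open>\<pp>\<close>, \<open>s\<close> is no multiple of
  \<open>a \<in> \<pp>\<close>, so \<open>a = s \<otimes> b\<close>. Primality gives
  \<open>b \<in> \<pp>\<close>, and cancelling \<open>s\<close> in the field leaves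
  \<open>t = b \<otimes> y\<close>.\<close>

lemma extended_ideal_cancel:
  assumes P: "primeideal \<pp> RV" and s: "s \<in> A \<inter> F - \<pp>" and t: "t \<in> A"
    and st: "s \<otimes> t \<in> extended_ideal \<pp>"
  shows "t \<in> extended_ideal \<pp>"
proof -
  note iffs = primeideal_RV_iff ideal_RV_iff
  obtain a y where ay: "a \<in> \<pp>" "y \<in> A" "s \<otimes> t = a \<otimes> y"
    using st unfolding extended_ideal_def by auto
  have aV: "a \<in> A \<inter> F" using P ay unfolding iffs by auto
  have "\<not> (\<exists>c\<in>A \<inter> F. s = a \<otimes> c)"
  proof
    assume "\<exists>c\<in>A \<inter> F. s = a \<otimes> c"
    then obtain c where c: "c \<in> A \<inter> F" "s = a \<otimes> c" by blast
    then have "s = c \<otimes> a" using aV A_closed(1) by (auto intro: m_comm)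
    then show False using P s c ay unfolding iffs by blast
  qed
  then obtain b where b: "b \<in> A \<inter> F" "a = s \<otimes> b"
    using divides_or_divides[of s a] s aV by blast
  have "b \<in> \<pp>" using P s b ay unfolding iffs by blast
  have c: "s \<in> carrier E" "b \<in> carrier E" "y \<in> carrier E" "t \<in> carrier E"
    using s b ay t A_closed(1) by auto
  have "s \<noteq> \<zero>" using P s unfolding iffs by auto
  moreover have "s \<otimes> t = s \<otimes> (b \<otimes> y)" using ay(3) b(2) c by (simp add: m_assoc)
  ultimately have "t = b \<otimes> y" using c m_lcancel by simp
  then show ?thesis using \<open>b \<in> \<pp>\<close> ay unfolding extended_ideal_def by blast
qed

lemma exists_primeideal_over:
  assumes P: "primeideal \<pp> RV"
    and U: "U \<subseteq> A" "\<one> \<in> U" "\<And>s t. \<lbrakk>s \<in> U; t \<in> U\<rbrakk> \<Longrightarrow> s \<otimes> t \<in> U"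
    and disj: "extended_ideal \<pp> \<inter> U = {}"
  obtains P where "primeideal P RA" "P \<inter> F = \<pp>" "P \<inter> U = {}"
proof -
  interpret RA: cring RA
    using subring_is_domain[OF A] by (rule domain.axioms(1))
  note iffs = primeideal_RV_iff ideal_RV_iff
  have pA: "\<pp> \<subseteq> A \<inter> F" and one: "\<one> \<in> A \<inter> F - \<pp>"
    using P A_closed F_closed unfolding iffs by auto
  \<comment> \<open>This multiplicative set contains both \<open>A \<inter> F - \<pp>\<close> and
    \<open>U\<close>, as \<open>\<one>\<close> lies in each. Avoiding the former bounds the trace of
    \<open>P\<close> by \<open>\<pp>\<close>.\<close>
  define S where "S = {s \<otimes> t | s t. s \<in> A \<inter> F - \<pp> \<and> t \<in> U}"
  have S_I: "s \<otimes> t \<in> S" if "s \<in> A \<inter> F - \<pp>" "t \<in> U" for s t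
    using that unfolding S_def by blast
  have S_U: "t \<in> S" if "t \<in> U" for t
  proof -
    have "t \<in> carrier E" using that U A_closed by auto
    then show ?thesis using S_I[OF one that] by simp
  qed
  have S_V: "s \<in> S" if "s \<in> A \<inter> F - \<pp>" for s
  proof -
    have "s \<in> carrier E" using that A_closed by auto
    then show ?thesis using S_I[OF that U(2)] by simp
  qed
  have p_mult: "s \<otimes> s' \<in> A \<inter> F - \<pp>" if "s \<in> A \<inter> F - \<pp>" "s' \<in> A \<inter> F - \<pp>" for s s'
    using that P A_closed(6) F_closed(6) unfolding primeideal_RV_iff by simp blast
  obtain P where P': "primeideal P RA" "extended_ideal \<pp> \<subseteq> P" "P \<inter> S = {}"
  proof (rule RA.exists_primeideal_disjoint[of "extended_ideal \<pp>" S])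
    show "ideal (extended_ideal \<pp>) RA"
      using P unfolding primeideal_RV_iff by (intro ideal_extended_ideal) blast
    show "S \<subseteq> carrier RA" using U(1) A_closed(6) unfolding S_def by auto
    show "\<one>\<^bsub>RA\<^esub> \<in> S" using S_U[OF U(2)] by simp
    show "x \<otimes>\<^bsub>RA\<^esub> y \<in> S" if "x \<in> S" "y \<in> S" for x y
    proof -
      obtain s t s' t' where h: "s \<in> A \<inter> F - \<pp>" "t \<in> U" "s' \<in> A \<inter> F - \<pp>" "t' \<in> U"
        "x = s \<otimes> t" "y = s' \<otimes> t'" using \<open>x \<in> S\<close> \<open>y \<in> S\<close> unfolding S_def by blast
      have "s \<in> carrier E" "t \<in> carrier E" "s' \<in> carrier E" "t' \<in> carrier E"
        using h U(1) A_closed(1) by auto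
      then have "x \<otimes> y = (s \<otimes> s') \<otimes> (t \<otimes> t')"
        unfolding h(5,6) by algebra
      then show ?thesis using S_I[OF p_mult[OF h(1,3)] U(3)[OF h(2,4)]] by simp
    qed
    \<comment> \<open>Cancelling \<open>s\<close> would put \<open>t \<in> U\<close> into the
      extended ideal.\<close>
    show "extended_ideal \<pp> \<inter> S = {}"
      using extended_ideal_cancel[OF P] disj U(1) unfolding S_def by blast
  qed
  have "\<pp> \<subseteq> P"
  proof
    fix a assume a: "a \<in> \<pp>"
    then have "a = a \<otimes> \<one>" using pA A_closed(1) by auto
    then show "a \<in> P" using P'(2) a A_closed(3) unfolding extended_ideal_def by blast
  qed
  moreover have "P \<inter> F \<subseteq> \<pp>"
    using P'(1,3) S_V unfolding primeideal_RA_iff ideal_RA_iff by blast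
  moreover have "P \<inter> U = {}" using P'(3) S_U by blast
  ultimately show thesis using that P'(1) pA by blast
qed

section \<open>Lying over, going down and lifting of chains\<close>

text \<open>If \<open>\<one> = a \<otimes> y\<close> with \<open>a \<in> \<pp>\<close>, then
  \<open>y = inv a\<close> lies in \<open>A \<inter> F\<close>, which forces
  \<open>\<one> \<in> \<pp>\<close>. Hence \<open>U = {\<one>}\<close> is admissible.\<close>

lemma lying_over:
  assumes "primeideal \<pp> RV"
  obtains P where "primeideal P RA" "P \<inter> F = \<pp>"
proof -
  have "\<one> \<notin> extended_ideal \<pp>"
  proof
    assume "\<one> \<in> extended_ideal \<pp>"
    then obtain a y where ay: "a \<in> \<pp>" "y \<in> A" "a \<otimes> y = \<one>"
      unfolding extended_ideal_def by auto
    have a: "a \<in> A" "a \<in> F" "a \<in> carrier E" "y \<in> carrier E"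
      using assms ay A_closed unfolding primeideal_RV_iff ideal_RV_iff by auto
    then have "a \<noteq> \<zero>" using ay(3) by auto
    moreover have "inv a = y" using a ay(3) by (simp add: comm_inv_char)
    ultimately have "y \<in> F" using F_inv_closed a by blast
    then have "y \<otimes> a \<in> \<pp>"
      using assms ay unfolding primeideal_RV_iff ideal_RV_iff by blast
    then have "\<one> \<in> \<pp>" using ay(3) m_comm[OF a(3,4)] by simp
    then show False using assms unfolding primeideal_RV_iff by blast
  qed
  then show thesis
    using exists_primeideal_over[OF assms, of "{\<one>}"] A_closed that by auto
qed

text \<open>Avoiding \<open>U = A - Q\<close> forces the new prime into \<open>Q\<close>; this is
  admissible because \<open>Q\<close> contains the extension of \<open>\<pp>\<close>.\<close>

lemma going_down:
  assumes "primeideal \<pp> RV" "primeideal Q RA" "\<pp> \<subseteq> Q"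
  obtains P where "primeideal P RA" "P \<inter> F = \<pp>" "P \<subseteq> Q"
proof -
  note iffs = primeideal_RA_iff ideal_RA_iff
  have sub: "extended_ideal \<pp> \<subseteq> Q"
  proof
    fix z assume "z \<in> extended_ideal \<pp>"
    then obtain a y where ay: "a \<in> \<pp>" "y \<in> A" "z = a \<otimes> y"
      unfolding extended_ideal_def by auto
    have "a \<in> Q" using assms(3) ay by blast
    moreover have "z = y \<otimes> a"
      using ay assms(2) \<open>a \<in> Q\<close> A_closed(1) unfolding iffs by (auto intro: m_comm)
    ultimately show "z \<in> Q" using ay assms(2) unfolding iffs by blast
  qed
  have "s \<otimes> t \<in> A - Q" if "s \<in> A - Q" "t \<in> A - Q" for s t
    using that assms(2) A_closed(6) unfolding primeideal_RA_iff by blast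
  moreover have "\<one> \<in> A - Q"
    using assms(2) A_closed(3) unfolding primeideal_RA_iff by blast
  moreover have "extended_ideal \<pp> \<inter> (A - Q) = {}" using sub by blast
  ultimately obtain P where P: "primeideal P RA" "P \<inter> F = \<pp>" "P \<inter> (A - Q) = {}"
    using exists_primeideal_over[OF assms(1), of "A - Q"] by blast
  have "P \<subseteq> A" using P(1) unfolding iffs by blast
  then have "P \<subseteq> Q" using P(3) by blast
  then show thesis using that P(1,2) by blast
qed

text \<open>The chain is built from its top: lying over lifts the largest prime, and each induction
  step adds a new smallest one by going down.\<close>

lemma lift_chain:
  assumes "\<forall>i\<le>n. primeideal (p i) RV" "\<forall>i<n. p i \<subset> p (Suc i)"
  shows "\<exists>P. (\<forall>i\<le>n. primeideal (P i) RA \<and> P i \<inter> F = p i) \<and> (\<forall>i<n. P i \<subset> P (Suc i))"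
  using assms
proof (induction n arbitrary: p)
  case 0
  obtain P where "primeideal P RA" "P \<inter> F = p 0"
    using lying_over[of "p 0"] 0 by auto
  then show ?case by (intro exI[of _ "\<lambda>_. P"]) auto
next
  case (Suc n)
  obtain P where P: "\<forall>i\<le>n. primeideal (P i) RA \<and> P i \<inter> F = p (Suc i)"
      "\<forall>i<n. P i \<subset> P (Suc i)"
    using Suc.IH[of "\<lambda>i. p (Suc i)"] Suc.prems by auto
  have strict: "p 0 \<subset> p (Suc 0)" and P0: "P 0 \<inter> F = p (Suc 0)"
    using Suc.prems P by auto
  then obtain Q where Q: "primeideal Q RA" "Q \<inter> F = p 0" "Q \<subseteq> P 0"
    using going_down[of "p 0" "P 0"] Suc.prems P by blast
  \<comment> \<open>Different traces exclude equality; \<open>case_nat Q P\<close> then puts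
    \<open>Q\<close> in front.\<close>
  have "Q \<subset> P 0" using Q strict P0 by blast
  then show ?case
    using P Q by (intro exI[of _ "case_nat Q P"]) (auto split: nat.split)
qed

theorem krull_dim_eq: "krull_dim RA = krull_dim RV"
proof -
  \<comment> \<open>The same chain lengths occur in both rings, so the suprema agree even when
    infinite.\<close>
  have "(\<exists>P. (\<forall>i\<le>n. primeideal (P i) RA) \<and> (\<forall>i<n. P i \<subset> P (Suc i))) \<longleftrightarrow>
      (\<exists>P. (\<forall>i\<le>n. primeideal (P i) RV) \<and> (\<forall>i<n. P i \<subset> P (Suc i)))" (is "?L \<longleftrightarrow> ?R") for n
  proof
    assume ?L
    then obtain P where P: "\<forall>i\<le>n. primeideal (P i) RA" "\<forall>i<n. P i \<subset> P (Suc i)" by blast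
    then have "(\<forall>i\<le>n. primeideal (P i \<inter> F) RV) \<and> (\<forall>i<n. P i \<inter> F \<subset> P (Suc i) \<inter> F)"
      using primeideal_contraction incomparability by auto
    then show ?R by (intro exI[of _ "\<lambda>i. P i \<inter> F"])
  next
    assume ?R
    then obtain p where "\<forall>i\<le>n. primeideal (p i) RV" "\<forall>i<n. p i \<subset> p (Suc i)" by blast
    from lift_chain[OF this] show ?L by blast
  qed
  then show ?thesis unfolding krull_dim_def by simp
qed

end

section \<open>Quasi-valuations extending a valuation\<close>

text \<open>A strictly monotone map on a total order also reflects the order, here against
  \<open>0 \<in> G\<close>; infinity goes to infinity.\<close>

lemma map_top_nonneg_iff:
  fixes \<iota> :: "'g :: {linorder, comm_monoid_add} \<Rightarrow> 'm :: {linorder, comm_monoid_add}"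
  assumes "\<iota> 0 = 0" "strict_mono_on G \<iota>" "0 \<in> G" "\<And>\<gamma>. y = top.Value \<gamma> \<Longrightarrow> \<gamma> \<in> G"
  shows "0 \<le> map_top \<iota> y \<longleftrightarrow> 0 \<le> y"
proof (cases y)
  case (Value \<gamma>)
  then show ?thesis
    using assms strict_mono_on_less_eq[of G \<iota> 0 \<gamma>] by (simp add: zero_top_def)
qed (simp add: zero_top_def)

context valuation
begin

lemma v_one: "v \<one> = 0"
proof -
  obtain g where g: "v \<one> = top.Value g"
    using v_eq_Top_iff[of \<one>] one_not_zero by (cases "v \<one>") auto
  then have "g = g + g" using v_mult[of \<one> \<one>] by simp
  then show ?thesis using g by (simp add: zero_top_def)
qed

text \<open>The value is finite with double zero, and ordered groups are torsion-free.\<close>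

lemma v_minus_one: "v (\<ominus> \<one>) = 0"
proof -
  obtain g where g: "v (\<ominus> \<one>) = top.Value g"
    using v_eq_Top_iff[of "\<ominus> \<one>"] one_not_zero by (cases "v (\<ominus> \<one>)") auto
  have "(\<ominus> \<one>) \<otimes> (\<ominus> \<one>) = \<one>" by (simp add: l_minus)
  then have "g + g = 0" using v_mult[of "\<ominus> \<one>" "\<ominus> \<one>"] g v_one by (simp add: zero_top_def)
  then show ?thesis using g by (simp add: zero_top_def)
qed

text \<open>The two values are finite and sum to zero, so they cannot both be negative.\<close>

lemma v_nonneg_or_inv_nonneg:
  assumes "x \<in> carrier K" "x \<noteq> \<zero>"
  shows "0 \<le> v x \<or> 0 \<le> v (inv x)"
proof -
  have x: "x \<in> Units K" using assms field_Units by auto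
  have "inv x \<noteq> \<zero>" using x assms by (metis Units_r_inv one_not_zero r_null)
  then obtain g h where gh: "v x = top.Value g" "v (inv x) = top.Value h"
    using assms x v_eq_Top_iff[of x] v_eq_Top_iff[of "inv x"]
    by (cases "v x"; cases "v (inv x)") auto
  have "g + h = 0"
    using v_mult[of x "inv x"] assms(1) x gh v_one by (simp add: zero_top_def Units_r_inv)
  then show ?thesis
    using gh by (simp add: zero_top_def) (metis add_nonneg_nonneg add_neg_neg less_irrefl not_le)
qed

end

text \<open>A quasi-valuation satisfies only inequalities, so its values at \<open>\<one>\<close>
  and \<open>\<ominus> \<one>\<close> are prescribed; the latter handles negation.\<close>

lemma (in quasi_valuation) subring_nonneg:
  assumes "w \<one> = 0" "w (\<ominus> \<one>) = 0"
  shows "subring {x \<in> carrier A. 0 \<le> w x} A"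
proof (rule subringI)
  fix x y assume h: "x \<in> {x \<in> carrier A. 0 \<le> w x}" "y \<in> {x \<in> carrier A. 0 \<le> w x}"
  then show "x \<otimes> y \<in> {x \<in> carrier A. 0 \<le> w x}"
    using order_trans[OF add_nonneg_nonneg[of "w x" "w y"] w_mult[of x y]] by simp
  show "x \<oplus> y \<in> {x \<in> carrier A. 0 \<le> w x}"
    using h w_add[of x y] by (auto simp: min_def split: if_splits)
next
  fix x assume h: "x \<in> {x \<in> carrier A. 0 \<le> w x}"
  then show "\<ominus> x \<in> {x \<in> carrier A. 0 \<le> w x}"
    using w_mult[of "\<ominus> \<one>" x] assms by (auto simp: l_minus)
qed (use assms in auto)

section \<open>Application to \<open>O_w\<close> and \<open>O_v\<close>\<close>

theorem corollary4p13:
  fixes E :: "('a, 'b) ring_scheme" and F :: "'a set"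
    and v :: "'a \<Rightarrow> ('g :: linordered_ab_group_add) top"
    and w :: "'a \<Rightarrow> ('m :: {linorder, ordered_comm_monoid_add}) top"
  assumes "field E"
    and "subfield F E"
    and "ring.finite_dimension E F (carrier E)"
    and "valuation (E\<lparr>carrier := F\<rparr>) v"
    and "quasi_valuation E w"
    and "extends_valuation F v w"
  shows "krull_dim (valuation_ring E w) = krull_dim (valuation_ring (E\<lparr>carrier := F\<rparr>) v)"
proof -
  interpret E: field E by fact
  interpret v: valuation "E\<lparr>carrier := F\<rparr>" v by fact
  interpret w: quasi_valuation E w by fact
  obtain \<iota> where \<iota>: "\<iota> 0 = 0" "strict_mono_on (value_group F v) \<iota>"
      "\<And>x. x \<in> F \<Longrightarrow> w x = map_top \<iota> (v x)"
    using assms(6) unfolding extends_valuation_def by blast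
  note F = subringE[OF subfieldE(1)[OF assms(2)]]
  \<comment> \<open>Zero is the value of one, so \<open>\<iota>\<close> preserves and reflects signs
    of values.\<close>
  have "0 \<in> value_group F v"
    using v.v_one F(3) unfolding value_group_def zero_top_def by auto
  then have nonneg_iff: "0 \<le> w x \<longleftrightarrow> 0 \<le> v x" if "x \<in> F" for x
    using map_top_nonneg_iff[of \<iota> "value_group F v" "v x"] \<iota> that
    unfolding value_group_def by auto
  \<comment> \<open>Negatives and inverses depend on the carrier; those of \<open>F\<close> must be
    identified with those of \<open>E\<close>.\<close>
  have minus_one: "\<ominus>\<^bsub>E\<lparr>carrier := F\<rparr>\<^esub> \<one>\<^bsub>E\<^esub> = \<ominus>\<^bsub>E\<^esub> \<one>\<^bsub>E\<^esub>"
  proof -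
    have "\<one>\<^bsub>E\<^esub> \<in> F" "\<ominus>\<^bsub>E\<^esub> \<one>\<^bsub>E\<^esub> \<in> F" using F by auto
    then show ?thesis
      using v.minus_equality[of "\<ominus>\<^bsub>E\<^esub> \<one>\<^bsub>E\<^esub>" "\<one>\<^bsub>E\<^esub>"] by (simp add: E.l_neg)
  qed
  define A where "A = {x \<in> carrier E. 0 \<le> w x}"
  have "w \<one>\<^bsub>E\<^esub> = 0" "w (\<ominus>\<^bsub>E\<^esub> \<one>\<^bsub>E\<^esub>) = 0"
    using \<iota>(1,3) F v.v_one v.v_minus_one minus_one by (auto simp: zero_top_def)
  then have A: "subring A E" unfolding A_def by (rule w.subring_nonneg)
  have dichotomy: "x \<in> A \<or> inv\<^bsub>E\<^esub> x \<in> A" if x: "x \<in> F" "x \<noteq> \<zero>\<^bsub>E\<^esub>" for x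
  proof -
    have "inv\<^bsub>E\<^esub> x \<in> F" using E.subfield_m_inv(1)[OF assms(2)] x by auto
    moreover have "inv\<^bsub>E\<lparr>carrier := F\<rparr>\<^esub> x = inv\<^bsub>E\<^esub> x"
    proof -
      have "x \<in> Units E" using x F(1) E.field_Units by auto
      then show ?thesis
        using x \<open>inv\<^bsub>E\<^esub> x \<in> F\<close> v.comm_inv_char[of x "inv\<^bsub>E\<^esub> x"] by simp
    qed
    ultimately show ?thesis
      using v.v_nonneg_or_inv_nonneg[of x] x nonneg_iff F(1) unfolding A_def by auto
  qed
  \<comment> \<open>Finiteness of the extension enters here, through algebraicity.\<close>
  interpret ext: algebraic_extension_of_valuation_ring E F A
    by (intro algebraic_extension_of_valuation_ring.intro
          algebraic_extension_of_valuation_ring_axioms.intro)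
      (fact assms(1,2) A dichotomy
        E.finite_dimension_imp_algebraic[OF assms(2) E.carrier_is_subring assms(3)])+
  \<comment> \<open>Agreement of signs on \<open>F\<close> makes \<open>O_v\<close> the trace of
    \<open>A\<close>.\<close>
  have "valuation_ring (E\<lparr>carrier := F\<rparr>) v = E\<lparr>carrier := A \<inter> F\<rparr>"
  proof -
    have "{x \<in> F. 0 \<le> v x} = A \<inter> F" using nonneg_iff F(1) unfolding A_def by auto
    then show ?thesis unfolding valuation_ring_def by simp
  qed
  moreover have "valuation_ring E w = E\<lparr>carrier := A\<rparr>"
    unfolding valuation_ring_def A_def ..
  ultimately show ?thesis using ext.krull_dim_eq by simp
qed

end
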